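(* Let $A$ be a unital associative algebra over a field $k$ and $(\Lambda,\lambda,D,d,a_0,u)\in\mathcal{F}(A)$ a flag datum of $A$. Then there exists an isomorphism of groups $$\mathrm{Gal}\bigl(A\ltimes_{(\Lambda,\lambda,D,d,a_0,u)}x\,/\,A\bigr)\cong\mathbb{G}_A(\Lambda,\lambda,D,d,a_0,u),$$ where $\mathbb{G}_A(\Lambda,\lambda,D,d,a_0,u)$ is the set of all pairs $(\alpha,q)\in A\times k^*$ such that for all $a\in A$: $$(1-q)D(a)=\alpha\,a-\Lambda(a)\,\alpha,\qquad (1-q)d(a)=a\,\alpha-\lambda(a)\,\alpha,$$ $$(1-q^2)a_0=\alpha^2-u\,\alpha+q\,d(\alpha)+q\,D(\alpha),\qquad (1-q)u=\lambda(\alpha)+\Lambda(\alpha),$$ with the multiplication $(\alpha,q)\cdot(\alpha',q')=(\alpha'+q'\alpha,\ qq')$.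
   Context: $k$ is an arbitrary field; "algebra" means unital associative $k$-algebra and algebra maps preserve units. For an extension of algebras $A\subseteq B$, $\mathrm{Gal}(B/A)$ is the group of algebra automorphisms of $B$ fixing every element of $A$. A flag datum of $A$ is a $6$-tuple $(\Lambda,\lambda,D,d,a_0,u)$ with $\Lambda,\lambda:A\to k$ algebra maps, $D,d:A\to A$ linear maps, $a_0\in A$, $u\in k$, such that for all $a,b\in A$: $\Lambda(a_0)=\lambda(a_0)$, $D(a_0)=d(a_0)$, $\lambda\circ d=0$, $\Lambda\circ D=0$; $d(ab)=a\,d(b)+d(a)\lambda(b)$, $D(ab)=\Lambda(a)D(b)+D(a)b$; $d^2(a)=u\,d(a)+a\,a_0-\lambda(a)a_0$, $D^2(a)=u\,D(a)+a_0\,a-\Lambda(a)a_0$; $D(d(a))-d(D(a))=(\Lambda(a)-\lambda(a))a_0$; $\Lambda(d(a))-\lambda(D(a))=(\Lambda(a)-\lambda(a))u$; $a\,D(b)+\Lambda(b)d(a)=d(a)\,b+\lambda(a)D(b)$. $\mathcal{F}(A)$ is the set of all flag datums of $A$. For a flag datum, $A\ltimes_{(\Lambda,\lambda,D,d,a_0,u)}x$ is the (unital associative) algebra on the vector space $A\oplus kx$ extending the multiplication of $A$ with $x^2=a_0+u\,x$, $ax=d(a)+\lambda(a)x$, $xa=D(a)+\Lambda(a)x$ for all $a\in A$. *)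

theory Defs
  imports "HOL-Algebra.Module" "HOL-Algebra.Bij"
begin

text \<open>The locale \<open>algebra\<close> of \<open>HOL-Algebra\<close> demands a commutative multiplication,
  so the noncommutative notion is introduced here.\<close>

locale assoc_algebra = K?: field K + module K A + A?: ring A
  for K (structure) and A (structure) +
  assumes smult_mult_left:
      "\<lbrakk>c \<in> carrier K; a \<in> carrier A; b \<in> carrier A\<rbrakk> \<Longrightarrow>
        (c \<odot>\<^bsub>A\<^esub> a) \<otimes>\<^bsub>A\<^esub> b = c \<odot>\<^bsub>A\<^esub> (a \<otimes>\<^bsub>A\<^esub> b)"
    and smult_mult_right:
      "\<lbrakk>c \<in> carrier K; a \<in> carrier A; b \<in> carrier A\<rbrakk> \<Longrightarrow>
        a \<otimes>\<^bsub>A\<^esub> (c \<odot>\<^bsub>A\<^esub> b) = c \<odot>\<^bsub>A\<^esub> (a \<otimes>\<^bsub>A\<^esub> b)"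

definition linear_maps ::
  "('k, 'm) ring_scheme \<Rightarrow> ('k, 'a, 'n) module_scheme \<Rightarrow> ('k, 'b, 'p) module_scheme \<Rightarrow> ('a \<Rightarrow> 'b) set"
  where "linear_maps K A B = {f \<in> carrier A \<rightarrow> carrier B.
    (\<forall>a\<in>carrier A. \<forall>b\<in>carrier A. f (a \<oplus>\<^bsub>A\<^esub> b) = f a \<oplus>\<^bsub>B\<^esub> f b) \<and>
    (\<forall>c\<in>carrier K. \<forall>a\<in>carrier A. f (c \<odot>\<^bsub>A\<^esub> a) = c \<odot>\<^bsub>B\<^esub> f a)}"

definition algebra_hom ::
  "('k, 'm) ring_scheme \<Rightarrow> ('k, 'a, 'n) module_scheme \<Rightarrow> ('k, 'b, 'p) module_scheme \<Rightarrow> ('a \<Rightarrow> 'b) set"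
  where "algebra_hom K A B = ring_hom A B \<inter> linear_maps K A B"

text \<open>The field as an algebra over itself, the target of the algebra maps in a flag datum.\<close>

definition field_algebra :: "('k, 'm) ring_scheme \<Rightarrow> ('k, 'k) module"
  where "field_algebra K =
    \<lparr>carrier = carrier K, mult = mult K, one = one K, zero = zero K, add = add K, smult = mult K\<rparr>"

text \<open>The second argument is the underlying set of the base algebra, as a subset of the
  extension. Automorphisms are extensional functions (undefined off the carrier), as in
  \<^const>\<open>BijGroup\<close>, whose product is composition: \<open>\<sigma> \<otimes> \<tau>\<close> is \<open>\<tau>\<close> followed by \<open>\<sigma>\<close>.\<close>

definition Gal ::
  "('k, 'm) ring_scheme \<Rightarrow> 'b set \<Rightarrow> ('k, 'b, 'p) module_scheme \<Rightarrow> ('b \<Rightarrow> 'b) monoid"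
  where "Gal K S B = BijGroup (carrier B)
    \<lparr>carrier := {\<sigma> \<in> algebra_hom K B B \<inter> Bij (carrier B). \<forall>s\<in>S. \<sigma> s = s}\<rparr>"

text \<open>In a flag datum, \<open>Lam\<close> and \<open>lam\<close> stand for the algebra maps usually written as a
  capital and a small lambda.\<close>

definition flag_data ::
  "('k, 'm) ring_scheme \<Rightarrow> ('k, 'a, 'n) module_scheme \<Rightarrow>
    (('a \<Rightarrow> 'k) \<times> ('a \<Rightarrow> 'k) \<times> ('a \<Rightarrow> 'a) \<times> ('a \<Rightarrow> 'a) \<times> 'a \<times> 'k) set"
  where "flag_data K A = {(Lam, lam, D, d, a0, u).
    Lam \<in> algebra_hom K A (field_algebra K) \<and>
    lam \<in> algebra_hom K A (field_algebra K) \<and>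
    D \<in> linear_maps K A A \<and> d \<in> linear_maps K A A \<and>
    a0 \<in> carrier A \<and> u \<in> carrier K \<and>
    Lam a0 = lam a0 \<and> D a0 = d a0 \<and>
    (\<forall>a\<in>carrier A. lam (d a) = \<zero>\<^bsub>K\<^esub> \<and> Lam (D a) = \<zero>\<^bsub>K\<^esub>) \<and>
    (\<forall>a\<in>carrier A. \<forall>b\<in>carrier A.
      d (a \<otimes>\<^bsub>A\<^esub> b) = a \<otimes>\<^bsub>A\<^esub> d b \<oplus>\<^bsub>A\<^esub> lam b \<odot>\<^bsub>A\<^esub> d a \<and>
      D (a \<otimes>\<^bsub>A\<^esub> b) = Lam a \<odot>\<^bsub>A\<^esub> D b \<oplus>\<^bsub>A\<^esub> D a \<otimes>\<^bsub>A\<^esub> b) \<and>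
    (\<forall>a\<in>carrier A.
      d (d a) = (u \<odot>\<^bsub>A\<^esub> d a \<oplus>\<^bsub>A\<^esub> a \<otimes>\<^bsub>A\<^esub> a0) \<ominus>\<^bsub>A\<^esub> lam a \<odot>\<^bsub>A\<^esub> a0 \<and>
      D (D a) = (u \<odot>\<^bsub>A\<^esub> D a \<oplus>\<^bsub>A\<^esub> a0 \<otimes>\<^bsub>A\<^esub> a) \<ominus>\<^bsub>A\<^esub> Lam a \<odot>\<^bsub>A\<^esub> a0 \<and>
      D (d a) \<ominus>\<^bsub>A\<^esub> d (D a) = (Lam a \<ominus>\<^bsub>K\<^esub> lam a) \<odot>\<^bsub>A\<^esub> a0 \<and>
      Lam (d a) \<ominus>\<^bsub>K\<^esub> lam (D a) = (Lam a \<ominus>\<^bsub>K\<^esub> lam a) \<otimes>\<^bsub>K\<^esub> u) \<and>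
    (\<forall>a\<in>carrier A. \<forall>b\<in>carrier A.
      a \<otimes>\<^bsub>A\<^esub> D b \<oplus>\<^bsub>A\<^esub> Lam b \<odot>\<^bsub>A\<^esub> d a = d a \<otimes>\<^bsub>A\<^esub> b \<oplus>\<^bsub>A\<^esub> lam a \<odot>\<^bsub>A\<^esub> D b)}"

text \<open>The pair \<open>(a, p)\<close> stands for \<open>a + p x\<close>. The product is the bilinear expansion of
  \<open>(a + p x) (b + r x)\<close> using \<open>x\<^sup>2 = a0 + u x\<close>, \<open>a x = d a + lam a x\<close> and
  \<open>x b = D b + Lam b x\<close>; these relations are recorded in the lemma below.\<close>

definition flag_ext ::
  "('k, 'm) ring_scheme \<Rightarrow> ('k, 'a, 'n) module_scheme \<Rightarrow>
    ('a \<Rightarrow> 'k) \<Rightarrow> ('a \<Rightarrow> 'k) \<Rightarrow> ('a \<Rightarrow> 'a) \<Rightarrow> ('a \<Rightarrow> 'a) \<Rightarrow> 'a \<Rightarrow> 'k \<Rightarrow> ('k, 'a \<times> 'k) module"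
  where "flag_ext K A Lam lam D d a0 u =
    \<lparr>carrier = carrier A \<times> carrier K,
     mult = (\<lambda>(a, p) (b, r).
       (a \<otimes>\<^bsub>A\<^esub> b \<oplus>\<^bsub>A\<^esub> r \<odot>\<^bsub>A\<^esub> d a \<oplus>\<^bsub>A\<^esub> p \<odot>\<^bsub>A\<^esub> D b \<oplus>\<^bsub>A\<^esub> (p \<otimes>\<^bsub>K\<^esub> r) \<odot>\<^bsub>A\<^esub> a0,
        r \<otimes>\<^bsub>K\<^esub> lam a \<oplus>\<^bsub>K\<^esub> p \<otimes>\<^bsub>K\<^esub> Lam b \<oplus>\<^bsub>K\<^esub> (p \<otimes>\<^bsub>K\<^esub> r) \<otimes>\<^bsub>K\<^esub> u)),
     one = (\<one>\<^bsub>A\<^esub>, \<zero>\<^bsub>K\<^esub>),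
     zero = (\<zero>\<^bsub>A\<^esub>, \<zero>\<^bsub>K\<^esub>),
     add = (\<lambda>(a, p) (b, r). (a \<oplus>\<^bsub>A\<^esub> b, p \<oplus>\<^bsub>K\<^esub> r)),
     smult = (\<lambda>c (a, p). (c \<odot>\<^bsub>A\<^esub> a, c \<otimes>\<^bsub>K\<^esub> p))\<rparr>"

definition base_of_ext ::
  "('k, 'm) ring_scheme \<Rightarrow> ('k, 'a, 'n) module_scheme \<Rightarrow> ('a \<times> 'k) set"
  where "base_of_ext K A = (\<lambda>a. (a, \<zero>\<^bsub>K\<^esub>)) ` carrier A"

definition flag_group ::
  "('k, 'm) ring_scheme \<Rightarrow> ('k, 'a, 'n) module_scheme \<Rightarrow>
    ('a \<Rightarrow> 'k) \<Rightarrow> ('a \<Rightarrow> 'k) \<Rightarrow> ('a \<Rightarrow> 'a) \<Rightarrow> ('a \<Rightarrow> 'a) \<Rightarrow> 'a \<Rightarrow> 'k \<Rightarrow> ('a \<times> 'k) monoid"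
  where "flag_group K A Lam lam D d a0 u =
    \<lparr>carrier = {(\<alpha>, q). \<alpha> \<in> carrier A \<and> q \<in> Units K \<and>
       (\<forall>a\<in>carrier A.
         (\<one>\<^bsub>K\<^esub> \<ominus>\<^bsub>K\<^esub> q) \<odot>\<^bsub>A\<^esub> D a = \<alpha> \<otimes>\<^bsub>A\<^esub> a \<ominus>\<^bsub>A\<^esub> Lam a \<odot>\<^bsub>A\<^esub> \<alpha> \<and>
         (\<one>\<^bsub>K\<^esub> \<ominus>\<^bsub>K\<^esub> q) \<odot>\<^bsub>A\<^esub> d a = a \<otimes>\<^bsub>A\<^esub> \<alpha> \<ominus>\<^bsub>A\<^esub> lam a \<odot>\<^bsub>A\<^esub> \<alpha>) \<and>
       (\<one>\<^bsub>K\<^esub> \<ominus>\<^bsub>K\<^esub> q [^]\<^bsub>K\<^esub> (2::nat)) \<odot>\<^bsub>A\<^esub> a0 =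
         (\<alpha> [^]\<^bsub>A\<^esub> (2::nat) \<ominus>\<^bsub>A\<^esub> u \<odot>\<^bsub>A\<^esub> \<alpha>) \<oplus>\<^bsub>A\<^esub> q \<odot>\<^bsub>A\<^esub> d \<alpha> \<oplus>\<^bsub>A\<^esub> q \<odot>\<^bsub>A\<^esub> D \<alpha> \<and>
       (\<one>\<^bsub>K\<^esub> \<ominus>\<^bsub>K\<^esub> q) \<otimes>\<^bsub>K\<^esub> u = lam \<alpha> \<oplus>\<^bsub>K\<^esub> Lam \<alpha>},
     mult = (\<lambda>(\<alpha>, q) (\<alpha>', q'). (\<alpha>' \<oplus>\<^bsub>A\<^esub> q' \<odot>\<^bsub>A\<^esub> \<alpha>, q \<otimes>\<^bsub>K\<^esub> q')),
     one = (\<zero>\<^bsub>A\<^esub>, \<one>\<^bsub>K\<^esub>)\<rparr>"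

lemma (in assoc_algebra) flag_ext_relations:
  fixes Lam lam D d a0 u
  defines "E \<equiv> flag_ext K A Lam lam D d a0 u" and "x \<equiv> (\<zero>\<^bsub>A\<^esub>, \<one>\<^bsub>K\<^esub>)"
  assumes F: "(Lam, lam, D, d, a0, u) \<in> flag_data K A"
  shows "x \<otimes>\<^bsub>E\<^esub> x = (a0, u)"
    and "a \<in> carrier A \<Longrightarrow> (a, \<zero>\<^bsub>K\<^esub>) \<otimes>\<^bsub>E\<^esub> x = (d a, lam a)"
    and "a \<in> carrier A \<Longrightarrow> x \<otimes>\<^bsub>E\<^esub> (a, \<zero>\<^bsub>K\<^esub>) = (D a, Lam a)"
    and "\<lbrakk>a \<in> carrier A; b \<in> carrier A\<rbrakk> \<Longrightarrow>
      (a, \<zero>\<^bsub>K\<^esub>) \<otimes>\<^bsub>E\<^esub> (b, \<zero>\<^bsub>K\<^esub>) = (a \<otimes>\<^bsub>A\<^esub> b, \<zero>\<^bsub>K\<^esub>)"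
    and "\<lbrakk>a \<in> carrier A; p \<in> carrier K\<rbrakk> \<Longrightarrow>
      (a, p) = (a, \<zero>\<^bsub>K\<^esub>) \<oplus>\<^bsub>E\<^esub> p \<odot>\<^bsub>E\<^esub> x"
proof -
  have z: "\<zero>\<^bsub>K\<^esub> \<odot>\<^bsub>A\<^esub> a = \<zero>\<^bsub>A\<^esub>" "c \<odot>\<^bsub>A\<^esub> \<zero>\<^bsub>A\<^esub> = \<zero>\<^bsub>A\<^esub>"
    if "a \<in> carrier A" "c \<in> carrier K" for a c
    using that by simp_all
  have cl: "a0 \<in> carrier A" "u \<in> carrier K"
    "\<And>a. a \<in> carrier A \<Longrightarrow> d a \<in> carrier A" "\<And>a. a \<in> carrier A \<Longrightarrow> D a \<in> carrier A"
    "\<And>a. a \<in> carrier A \<Longrightarrow> lam a \<in> carrier K" "\<And>a. a \<in> carrier A \<Longrightarrow> Lam a \<in> carrier K"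
    using F by (auto simp: flag_data_def algebra_hom_def linear_maps_def field_algebra_def)
  have lin0: "f \<zero>\<^bsub>A\<^esub> = \<zero>\<^bsub>K\<^esub> \<odot>\<^bsub>A\<^esub> f \<zero>\<^bsub>A\<^esub>" if "f \<in> linear_maps K A A" for f
  proof -
    have "f (\<zero>\<^bsub>K\<^esub> \<odot>\<^bsub>A\<^esub> \<zero>\<^bsub>A\<^esub>) = \<zero>\<^bsub>K\<^esub> \<odot>\<^bsub>A\<^esub> f \<zero>\<^bsub>A\<^esub>"
      using that by (simp add: linear_maps_def del: smult_r_null smult_l_null)
    then show ?thesis by simp
  qed
  have char0: "f \<zero>\<^bsub>A\<^esub> = \<zero>\<^bsub>K\<^esub> \<otimes>\<^bsub>K\<^esub> f \<zero>\<^bsub>A\<^esub>"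
    if "f \<in> linear_maps K A (field_algebra K)" for f
  proof -
    have "f (\<zero>\<^bsub>K\<^esub> \<odot>\<^bsub>A\<^esub> \<zero>\<^bsub>A\<^esub>) = \<zero>\<^bsub>K\<^esub> \<otimes>\<^bsub>K\<^esub> f \<zero>\<^bsub>A\<^esub>"
      using that
      by (simp add: linear_maps_def field_algebra_def del: smult_r_null smult_l_null)
    then show ?thesis by simp
  qed
  have "d \<zero>\<^bsub>A\<^esub> = \<zero>\<^bsub>A\<^esub>" "D \<zero>\<^bsub>A\<^esub> = \<zero>\<^bsub>A\<^esub>"
    using F lin0[of d] lin0[of D] cl by (simp_all add: flag_data_def)
  moreover have "lam \<zero>\<^bsub>A\<^esub> = \<zero>\<^bsub>K\<^esub>" "Lam \<zero>\<^bsub>A\<^esub> = \<zero>\<^bsub>K\<^esub>"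
    using F char0[of lam] char0[of Lam] cl by (simp_all add: flag_data_def algebra_hom_def)
  ultimately show "x \<otimes>\<^bsub>E\<^esub> x = (a0, u)"
    and "a \<in> carrier A \<Longrightarrow> (a, \<zero>\<^bsub>K\<^esub>) \<otimes>\<^bsub>E\<^esub> x = (d a, lam a)"
    and "a \<in> carrier A \<Longrightarrow> x \<otimes>\<^bsub>E\<^esub> (a, \<zero>\<^bsub>K\<^esub>) = (D a, Lam a)"
    and "\<lbrakk>a \<in> carrier A; b \<in> carrier A\<rbrakk> \<Longrightarrow>
      (a, \<zero>\<^bsub>K\<^esub>) \<otimes>\<^bsub>E\<^esub> (b, \<zero>\<^bsub>K\<^esub>) = (a \<otimes>\<^bsub>A\<^esub> b, \<zero>\<^bsub>K\<^esub>)"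
    and "\<lbrakk>a \<in> carrier A; p \<in> carrier K\<rbrakk> \<Longrightarrow>
      (a, p) = (a, \<zero>\<^bsub>K\<^esub>) \<oplus>\<^bsub>E\<^esub> p \<odot>\<^bsub>E\<^esub> x"
    using cl by (simp_all add: E_def x_def flag_ext_def z)
qed

end

theory Submission
  imports Defs
begin

text \<open>An algebra endomorphism \<open>\<sigma>\<close> of \<open>A \<oplus> k x\<close> that fixes \<open>A\<close> is determined by
  \<open>\<sigma> x = \<alpha> + q x\<close>, and since the multiplication is bilinear, a linear map of this shape is
  multiplicative as soon as it respects the three products \<open>x a\<close>, \<open>a x\<close> and \<open>x x\<close>. Comparing
  coefficients there gives the equations of \<open>flag_group\<close>. Injectivity forces \<open>q \<noteq> 0\<close>, as
  otherwise \<open>\<sigma> x = \<sigma> \<alpha>\<close>, and \<open>(\<sigma> \<circ> \<sigma>') x = \<alpha>' + q' \<alpha> + q' q x\<close> matches the product of pairs.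
  The group axioms for the pairs are transported along this bijection.\<close>

section \<open>Automorphisms fixing a subset form a group\<close>

lemma algebra_hom_iff:
  "f \<in> algebra_hom K A B \<longleftrightarrow>
    (\<forall>x\<in>carrier A. f x \<in> carrier B) \<and> f \<one>\<^bsub>A\<^esub> = \<one>\<^bsub>B\<^esub> \<and>
    (\<forall>x\<in>carrier A. \<forall>y\<in>carrier A. f (x \<otimes>\<^bsub>A\<^esub> y) = f x \<otimes>\<^bsub>B\<^esub> f y) \<and>
    (\<forall>x\<in>carrier A. \<forall>y\<in>carrier A. f (x \<oplus>\<^bsub>A\<^esub> y) = f x \<oplus>\<^bsub>B\<^esub> f y) \<and>
    (\<forall>c\<in>carrier K. \<forall>x\<in>carrier A. f (c \<odot>\<^bsub>A\<^esub> x) = c \<odot>\<^bsub>B\<^esub> f x)"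
  unfolding algebra_hom_def ring_hom_def linear_maps_def by blast

text \<open>These maps form a subgroup of \<open>BijGroup\<close>. Automorphisms here are
  extensional, so they behave well only on the carrier; closure under the operations keeps every
  sum, product and multiple in the laws there. It can be read off the product formula of the
  extension.\<close>

lemma group_Gal:
  assumes one: "\<one>\<^bsub>B\<^esub> \<in> carrier B"
    and mult: "\<And>x y. x \<in> carrier B \<Longrightarrow> y \<in> carrier B \<Longrightarrow> x \<otimes>\<^bsub>B\<^esub> y \<in> carrier B"
    and add: "\<And>x y. x \<in> carrier B \<Longrightarrow> y \<in> carrier B \<Longrightarrow> x \<oplus>\<^bsub>B\<^esub> y \<in> carrier B"
    and smult: "\<And>c x. c \<in> carrier K \<Longrightarrow> x \<in> carrier B \<Longrightarrow> c \<odot>\<^bsub>B\<^esub> x \<in> carrier B"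
    and S: "S \<subseteq> carrier B"
  shows "group (Gal K S B)"
proof -
  let ?H = "{\<sigma> \<in> algebra_hom K B B \<inter> Bij (carrier B). \<forall>s\<in>S. \<sigma> s = s}"
  have "subgroup ?H (BijGroup (carrier B))"
  proof (rule group.subgroupI[OF group_BijGroup])
    show "?H \<subseteq> carrier (BijGroup (carrier B))"
      by (auto simp: BijGroup_def)
    \<comment> \<open>The unit of \<open>BijGroup\<close> is the restricted identity; it respects
      the operations because their results stay in the carrier.\<close>
    have "(\<lambda>x\<in>carrier B. x) \<in> ?H"
      using S by (simp add: id_Bij algebra_hom_iff one mult add smult subset_iff)
    then show "?H \<noteq> {}" by blast
  next
    fix f assume f: "f \<in> ?H"
    let ?h = "\<lambda>x\<in>carrier B. inv_into (carrier B) f x"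
    have fB: "f \<in> Bij (carrier B)" and f_fix: "\<And>s. s \<in> S \<Longrightarrow> f s = s"
      using f by simp_all
    have bij: "bij_betw f (carrier B) (carrier B)"
      using fB by (simp add: Bij_def)
    have hB: "?h \<in> Bij (carrier B)"
      by (rule restrict_inv_into_Bij[OF fB])
    define h where "h = ?h"
    have h: "h y \<in> carrier B" "f (h y) = y" if "y \<in> carrier B" for y
      using bij that by (simp_all add: h_def bij_betw_def inv_into_into f_inv_into_f)
    \<comment> \<open>A value of the inverse is identified by exhibiting a preimage under
      \<open>f\<close>. Each law for \<open>h\<close> thereby reduces to the same law for
      \<open>f\<close>.\<close>
    have h_eq: "h y = x" if "x \<in> carrier B" "y \<in> carrier B" "f x = y" for x y
      using bij that by (simp add: h_def bij_betw_def inv_into_f_eq)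
    have f_hom: "f \<one>\<^bsub>B\<^esub> = \<one>\<^bsub>B\<^esub>"
      "\<And>x y. x \<in> carrier B \<Longrightarrow> y \<in> carrier B \<Longrightarrow> f (x \<otimes>\<^bsub>B\<^esub> y) = f x \<otimes>\<^bsub>B\<^esub> f y"
      "\<And>x y. x \<in> carrier B \<Longrightarrow> y \<in> carrier B \<Longrightarrow> f (x \<oplus>\<^bsub>B\<^esub> y) = f x \<oplus>\<^bsub>B\<^esub> f y"
      "\<And>c x. c \<in> carrier K \<Longrightarrow> x \<in> carrier B \<Longrightarrow> f (c \<odot>\<^bsub>B\<^esub> x) = c \<odot>\<^bsub>B\<^esub> f x"
      using f by (simp_all add: algebra_hom_iff)
    have "h s = s" if "s \<in> S" for s
      using S that by (intro h_eq f_fix) auto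
    moreover have "h \<in> algebra_hom K B B"
      unfolding algebra_hom_iff by (intro conjI ballI h_eq) (simp_all add: h f_hom one mult add smult)
    ultimately show "inv\<^bsub>BijGroup (carrier B)\<^esub> f \<in> ?H"
      using hB by (simp add: inv_BijGroup[OF fB] flip: h_def)
  next
    fix f g assume fg: "f \<in> ?H" "g \<in> ?H"
    have "compose (carrier B) f g \<in> ?H"
      using fg S
      by (simp add: algebra_hom_iff compose_Bij compose_eq subset_iff one mult add smult)
    then show "f \<otimes>\<^bsub>BijGroup (carrier B)\<^esub> g \<in> ?H"
      using fg by (simp add: BijGroup_def)
  qed
  then show ?thesis
    unfolding Gal_def by (rule subgroup.subgroup_is_group[OF _ group_BijGroup])
qed
text \<open>Adding \<open>y \<oplus> w\<close> to both sides removes the subtractions and can be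
  cancelled again. This serves to bring the equations of \<open>flag_group\<close> into a form
  suited to distributivity and AC rewriting.\<close>

lemma (in abelian_group) minus_eq_minus_iff:
  assumes "x \<in> carrier G" "y \<in> carrier G" "z \<in> carrier G" "w \<in> carrier G"
  shows "x \<ominus> y = z \<ominus> w \<longleftrightarrow> x \<oplus> w = z \<oplus> y"
proof -
  have 1: "(x \<ominus> y) \<oplus> (y \<oplus> w) = x \<oplus> w"
    using assms by (simp add: minus_eq a_assoc r_neg1)
  have 2: "(z \<ominus> w) \<oplus> (y \<oplus> w) = z \<oplus> y"
    using assms by (simp add: minus_eq a_assoc r_neg1 a_comm[of y w])
  show ?thesis
    using assms by (simp flip: 1 2)
qed

lemma (in module) one_minus_smult:
  assumes "q \<in> carrier R" "x \<in> carrier M"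
  shows "(\<one> \<ominus> q) \<odot>\<^bsub>M\<^esub> x = x \<ominus>\<^bsub>M\<^esub> q \<odot>\<^bsub>M\<^esub> x"
  using assms by (simp add: R.minus_eq M.minus_eq smult_l_distr smult_l_minus)

section \<open>The extension by \<open>x\<close> and its candidate automorphisms\<close>

locale flag_extension = assoc_algebra K A
  for K (structure) and A (structure) +
  fixes Lam lam D d a0 u
  assumes flag: "(Lam, lam, D, d, a0, u) \<in> flag_data K A"
begin

abbreviation E where "E \<equiv> flag_ext K A Lam lam D d a0 u"

text \<open>The linear map that is the identity on \<open>A\<close> and sends \<open>x\<close> to
  \<alpha> + q x. It makes sense for every pair; the equations of \<open>flag_group\<close> decide
  whether it is an automorphism. The restriction to the carrier makes it extensional, as
  \<open>BijGroup\<close> demands.\<close>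

definition flag_aut where
  "flag_aut = (\<lambda>(\<alpha>, q). \<lambda>(a, p)\<in>carrier A \<times> carrier K. (a \<oplus>\<^bsub>A\<^esub> p \<odot>\<^bsub>A\<^esub> \<alpha>, p \<otimes>\<^bsub>K\<^esub> q))"

lemma flag_closed [simp]:
  "a0 \<in> carrier A" "u \<in> carrier K"
  "a \<in> carrier A \<Longrightarrow> d a \<in> carrier A" "a \<in> carrier A \<Longrightarrow> D a \<in> carrier A"
  "a \<in> carrier A \<Longrightarrow> lam a \<in> carrier K" "a \<in> carrier A \<Longrightarrow> Lam a \<in> carrier K"
  using flag by (auto simp: flag_data_def algebra_hom_def linear_maps_def field_algebra_def)

lemma flag_add:
  assumes "a \<in> carrier A" "b \<in> carrier A"
  shows "d (a \<oplus>\<^bsub>A\<^esub> b) = d a \<oplus>\<^bsub>A\<^esub> d b" "D (a \<oplus>\<^bsub>A\<^esub> b) = D a \<oplus>\<^bsub>A\<^esub> D b"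
    "lam (a \<oplus>\<^bsub>A\<^esub> b) = lam a \<oplus>\<^bsub>K\<^esub> lam b" "Lam (a \<oplus>\<^bsub>A\<^esub> b) = Lam a \<oplus>\<^bsub>K\<^esub> Lam b"
  using flag assms by (auto simp: flag_data_def algebra_hom_def linear_maps_def field_algebra_def)

lemma flag_smult:
  assumes "a \<in> carrier A" "c \<in> carrier K"
  shows "d (c \<odot>\<^bsub>A\<^esub> a) = c \<odot>\<^bsub>A\<^esub> d a" "D (c \<odot>\<^bsub>A\<^esub> a) = c \<odot>\<^bsub>A\<^esub> D a"
    "lam (c \<odot>\<^bsub>A\<^esub> a) = c \<otimes>\<^bsub>K\<^esub> lam a" "Lam (c \<odot>\<^bsub>A\<^esub> a) = c \<otimes>\<^bsub>K\<^esub> Lam a"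
  using flag assms by (auto simp: flag_data_def algebra_hom_def linear_maps_def field_algebra_def)

lemma flag_ext_simps [simp]:
  "carrier E = carrier A \<times> carrier K" "\<one>\<^bsub>E\<^esub> = (\<one>\<^bsub>A\<^esub>, \<zero>\<^bsub>K\<^esub>)"
  "(a, p) \<oplus>\<^bsub>E\<^esub> (b, r) = (a \<oplus>\<^bsub>A\<^esub> b, p \<oplus>\<^bsub>K\<^esub> r)"
  "c \<odot>\<^bsub>E\<^esub> (a, p) = (c \<odot>\<^bsub>A\<^esub> a, c \<otimes>\<^bsub>K\<^esub> p)"
  by (simp_all add: flag_ext_def)

lemma flag_ext_mult:
  "(a, p) \<otimes>\<^bsub>E\<^esub> (b, r) =
    (a \<otimes>\<^bsub>A\<^esub> b \<oplus>\<^bsub>A\<^esub> r \<odot>\<^bsub>A\<^esub> d a \<oplus>\<^bsub>A\<^esub> p \<odot>\<^bsub>A\<^esub> D b \<oplus>\<^bsub>A\<^esub> (p \<otimes>\<^bsub>K\<^esub> r) \<odot>\<^bsub>A\<^esub> a0,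
     r \<otimes>\<^bsub>K\<^esub> lam a \<oplus>\<^bsub>K\<^esub> p \<otimes>\<^bsub>K\<^esub> Lam b \<oplus>\<^bsub>K\<^esub> (p \<otimes>\<^bsub>K\<^esub> r) \<otimes>\<^bsub>K\<^esub> u)"
  by (simp add: flag_ext_def)

lemma base_of_ext_subset: "base_of_ext K A \<subseteq> carrier E"
  by (auto simp: base_of_ext_def)

lemma group_Gal_flag_ext: "group (Gal K (base_of_ext K A) E)"
  by (rule group_Gal[OF _ _ _ _ base_of_ext_subset]) (auto simp: flag_ext_mult)

text \<open>The defining equations with both sides moved so that no subtraction occurs: they then say
  \<open>\<sigma> (x a) = \<sigma> x a\<close>, \<open>\<sigma> (a x) = a \<sigma> x\<close> and, with the factor \<open>q\<close> cancelled in the last one,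
  \<open>\<sigma> (x x) = \<sigma> x \<sigma> x\<close> for \<open>\<sigma> x = \<alpha> + q x\<close>.\<close>

lemma carrier_flag_group_iff:
  "(\<alpha>, q) \<in> carrier (flag_group K A Lam lam D d a0 u) \<longleftrightarrow>
    \<alpha> \<in> carrier A \<and> q \<in> Units K \<and>
    (\<forall>a\<in>carrier A.
      D a \<oplus>\<^bsub>A\<^esub> Lam a \<odot>\<^bsub>A\<^esub> \<alpha> = \<alpha> \<otimes>\<^bsub>A\<^esub> a \<oplus>\<^bsub>A\<^esub> q \<odot>\<^bsub>A\<^esub> D a \<and>
      d a \<oplus>\<^bsub>A\<^esub> lam a \<odot>\<^bsub>A\<^esub> \<alpha> = a \<otimes>\<^bsub>A\<^esub> \<alpha> \<oplus>\<^bsub>A\<^esub> q \<odot>\<^bsub>A\<^esub> d a) \<and>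
    a0 \<oplus>\<^bsub>A\<^esub> u \<odot>\<^bsub>A\<^esub> \<alpha> =
      \<alpha> \<otimes>\<^bsub>A\<^esub> \<alpha> \<oplus>\<^bsub>A\<^esub> q \<odot>\<^bsub>A\<^esub> d \<alpha> \<oplus>\<^bsub>A\<^esub> q \<odot>\<^bsub>A\<^esub> D \<alpha> \<oplus>\<^bsub>A\<^esub> (q \<otimes>\<^bsub>K\<^esub> q) \<odot>\<^bsub>A\<^esub> a0 \<and>
    u = lam \<alpha> \<oplus>\<^bsub>K\<^esub> Lam \<alpha> \<oplus>\<^bsub>K\<^esub> q \<otimes>\<^bsub>K\<^esub> u"
proof (cases "\<alpha> \<in> carrier A \<and> q \<in> Units K")
  case True
  then have [simp]: "\<alpha> \<in> carrier A" "q \<in> carrier K" "q \<in> Units K" by auto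
  have 1: "(\<one>\<^bsub>K\<^esub> \<ominus>\<^bsub>K\<^esub> q) \<odot>\<^bsub>A\<^esub> D a = \<alpha> \<otimes>\<^bsub>A\<^esub> a \<ominus>\<^bsub>A\<^esub> Lam a \<odot>\<^bsub>A\<^esub> \<alpha> \<longleftrightarrow>
      D a \<oplus>\<^bsub>A\<^esub> Lam a \<odot>\<^bsub>A\<^esub> \<alpha> = \<alpha> \<otimes>\<^bsub>A\<^esub> a \<oplus>\<^bsub>A\<^esub> q \<odot>\<^bsub>A\<^esub> D a" if "a \<in> carrier A" for a
    using that by (simp add: one_minus_smult M.minus_eq_minus_iff)
  have 2: "(\<one>\<^bsub>K\<^esub> \<ominus>\<^bsub>K\<^esub> q) \<odot>\<^bsub>A\<^esub> d a = a \<otimes>\<^bsub>A\<^esub> \<alpha> \<ominus>\<^bsub>A\<^esub> lam a \<odot>\<^bsub>A\<^esub> \<alpha> \<longleftrightarrow>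
      d a \<oplus>\<^bsub>A\<^esub> lam a \<odot>\<^bsub>A\<^esub> \<alpha> = a \<otimes>\<^bsub>A\<^esub> \<alpha> \<oplus>\<^bsub>A\<^esub> q \<odot>\<^bsub>A\<^esub> d a" if "a \<in> carrier A" for a
    using that by (simp add: one_minus_smult M.minus_eq_minus_iff)
  \<comment> \<open>The subtracted term moves to the end, so that the right side is a single
    difference.\<close>
  have "(\<alpha> \<otimes>\<^bsub>A\<^esub> \<alpha> \<ominus>\<^bsub>A\<^esub> u \<odot>\<^bsub>A\<^esub> \<alpha>) \<oplus>\<^bsub>A\<^esub> q \<odot>\<^bsub>A\<^esub> d \<alpha> \<oplus>\<^bsub>A\<^esub> q \<odot>\<^bsub>A\<^esub> D \<alpha> =
      (\<alpha> \<otimes>\<^bsub>A\<^esub> \<alpha> \<oplus>\<^bsub>A\<^esub> q \<odot>\<^bsub>A\<^esub> d \<alpha> \<oplus>\<^bsub>A\<^esub> q \<odot>\<^bsub>A\<^esub> D \<alpha>) \<ominus>\<^bsub>A\<^esub> u \<odot>\<^bsub>A\<^esub> \<alpha>"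
    by (simp add: M.minus_eq M.a_ac)
  moreover have "q [^]\<^bsub>K\<^esub> (2::nat) = q \<otimes>\<^bsub>K\<^esub> q" "\<alpha> [^]\<^bsub>A\<^esub> (2::nat) = \<alpha> \<otimes>\<^bsub>A\<^esub> \<alpha>"
    by (simp_all add: numeral_2_eq_2)
  ultimately have 3: "(\<one>\<^bsub>K\<^esub> \<ominus>\<^bsub>K\<^esub> q [^]\<^bsub>K\<^esub> (2::nat)) \<odot>\<^bsub>A\<^esub> a0 =
         (\<alpha> [^]\<^bsub>A\<^esub> (2::nat) \<ominus>\<^bsub>A\<^esub> u \<odot>\<^bsub>A\<^esub> \<alpha>) \<oplus>\<^bsub>A\<^esub> q \<odot>\<^bsub>A\<^esub> d \<alpha> \<oplus>\<^bsub>A\<^esub> q \<odot>\<^bsub>A\<^esub> D \<alpha> \<longleftrightarrow>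
      a0 \<oplus>\<^bsub>A\<^esub> u \<odot>\<^bsub>A\<^esub> \<alpha> =
      \<alpha> \<otimes>\<^bsub>A\<^esub> \<alpha> \<oplus>\<^bsub>A\<^esub> q \<odot>\<^bsub>A\<^esub> d \<alpha> \<oplus>\<^bsub>A\<^esub> q \<odot>\<^bsub>A\<^esub> D \<alpha> \<oplus>\<^bsub>A\<^esub> (q \<otimes>\<^bsub>K\<^esub> q) \<odot>\<^bsub>A\<^esub> a0"
    by (simp add: one_minus_smult M.minus_eq_minus_iff)
  have "(\<one>\<^bsub>K\<^esub> \<ominus>\<^bsub>K\<^esub> q) \<otimes>\<^bsub>K\<^esub> u = u \<ominus>\<^bsub>K\<^esub> q \<otimes>\<^bsub>K\<^esub> u"
    by (simp add: K.minus_eq K.l_distr K.l_minus)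
  \<comment> \<open>Subtracting zero gives this side the shape of a difference too.\<close>
  moreover have "lam \<alpha> \<oplus>\<^bsub>K\<^esub> Lam \<alpha> = (lam \<alpha> \<oplus>\<^bsub>K\<^esub> Lam \<alpha>) \<ominus>\<^bsub>K\<^esub> \<zero>\<^bsub>K\<^esub>"
    by (simp add: K.minus_eq)
  ultimately have 4: "(\<one>\<^bsub>K\<^esub> \<ominus>\<^bsub>K\<^esub> q) \<otimes>\<^bsub>K\<^esub> u = lam \<alpha> \<oplus>\<^bsub>K\<^esub> Lam \<alpha> \<longleftrightarrow>
      u = lam \<alpha> \<oplus>\<^bsub>K\<^esub> Lam \<alpha> \<oplus>\<^bsub>K\<^esub> q \<otimes>\<^bsub>K\<^esub> u"
    using K.minus_eq_minus_iff[of u "q \<otimes>\<^bsub>K\<^esub> u" "lam \<alpha> \<oplus>\<^bsub>K\<^esub> Lam \<alpha>" "\<zero>\<^bsub>K\<^esub>"] by simp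
  show ?thesis
    unfolding flag_group_def using 1 2 3 4 by simp
qed (auto simp: flag_group_def)

section \<open>From pairs to automorphisms\<close>

lemma flag_aut_in_Gal:
  assumes G: "(\<alpha>, q) \<in> carrier (flag_group K A Lam lam D d a0 u)"
  shows "flag_aut (\<alpha>, q) \<in> carrier (Gal K (base_of_ext K A) E)"
proof -
  define f where "f = flag_aut (\<alpha>, q)"
  have \<alpha>[simp]: "\<alpha> \<in> carrier A" and q: "q \<in> Units K"
    and eqs: "\<And>a. a \<in> carrier A \<Longrightarrow>
        D a \<oplus>\<^bsub>A\<^esub> Lam a \<odot>\<^bsub>A\<^esub> \<alpha> = \<alpha> \<otimes>\<^bsub>A\<^esub> a \<oplus>\<^bsub>A\<^esub> q \<odot>\<^bsub>A\<^esub> D a"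
      "\<And>a. a \<in> carrier A \<Longrightarrow>
        d a \<oplus>\<^bsub>A\<^esub> lam a \<odot>\<^bsub>A\<^esub> \<alpha> = a \<otimes>\<^bsub>A\<^esub> \<alpha> \<oplus>\<^bsub>A\<^esub> q \<odot>\<^bsub>A\<^esub> d a"
      "a0 \<oplus>\<^bsub>A\<^esub> u \<odot>\<^bsub>A\<^esub> \<alpha> =
        \<alpha> \<otimes>\<^bsub>A\<^esub> \<alpha> \<oplus>\<^bsub>A\<^esub> q \<odot>\<^bsub>A\<^esub> d \<alpha> \<oplus>\<^bsub>A\<^esub> q \<odot>\<^bsub>A\<^esub> D \<alpha> \<oplus>\<^bsub>A\<^esub> (q \<otimes>\<^bsub>K\<^esub> q) \<odot>\<^bsub>A\<^esub> a0"
    and eq_u: "u = lam \<alpha> \<oplus>\<^bsub>K\<^esub> Lam \<alpha> \<oplus>\<^bsub>K\<^esub> q \<otimes>\<^bsub>K\<^esub> u"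
    using G by (simp_all add: carrier_flag_group_iff)
  have [simp]: "q \<in> carrier K" using q by auto
  have f [simp]: "f (a, p) = (a \<oplus>\<^bsub>A\<^esub> p \<odot>\<^bsub>A\<^esub> \<alpha>, p \<otimes>\<^bsub>K\<^esub> q)"
    if "a \<in> carrier A" "p \<in> carrier K" for a p
    using that by (simp add: f_def flag_aut_def)
  have f_add: "f ((a, p) \<oplus>\<^bsub>E\<^esub> (b, r)) = f (a, p) \<oplus>\<^bsub>E\<^esub> f (b, r)"
    if "a \<in> carrier A" "p \<in> carrier K" "b \<in> carrier A" "r \<in> carrier K" for a p b r
    using that by (simp add: smult_l_distr K.l_distr M.a_ac)
  have f_smult: "f (c \<odot>\<^bsub>E\<^esub> (a, p)) = c \<odot>\<^bsub>E\<^esub> f (a, p)"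
    if "a \<in> carrier A" "p \<in> carrier K" "c \<in> carrier K" for a p c
    using that by (simp add: smult_r_distr smult_assoc1 K.m_assoc)
  have f_mult: "f ((a, p) \<otimes>\<^bsub>E\<^esub> (b, r)) = f (a, p) \<otimes>\<^bsub>E\<^esub> f (b, r)"
    if [simp]: "a \<in> carrier A" "p \<in> carrier K" "b \<in> carrier A" "r \<in> carrier K" for a p b r
  proof -
    \<comment> \<open>This is the \<open>A\<close>-component of the image of the product. The
      grouping makes each bracket the left side of one equation in \<open>eqs\<close>, belonging to
      \<open>a x\<close>, \<open>x b\<close> and \<open>x x\<close>; the brackets are replaced
      before anything is expanded.\<close>
    have "a \<otimes>\<^bsub>A\<^esub> b \<oplus>\<^bsub>A\<^esub> r \<odot>\<^bsub>A\<^esub> d a \<oplus>\<^bsub>A\<^esub> p \<odot>\<^bsub>A\<^esub> D b \<oplus>\<^bsub>A\<^esub> (p \<otimes>\<^bsub>K\<^esub> r) \<odot>\<^bsub>A\<^esub> a0 \<oplus>\<^bsub>A\<^esub>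
        (r \<otimes>\<^bsub>K\<^esub> lam a \<oplus>\<^bsub>K\<^esub> p \<otimes>\<^bsub>K\<^esub> Lam b \<oplus>\<^bsub>K\<^esub> (p \<otimes>\<^bsub>K\<^esub> r) \<otimes>\<^bsub>K\<^esub> u) \<odot>\<^bsub>A\<^esub> \<alpha> =
      a \<otimes>\<^bsub>A\<^esub> b \<oplus>\<^bsub>A\<^esub> r \<odot>\<^bsub>A\<^esub> (d a \<oplus>\<^bsub>A\<^esub> lam a \<odot>\<^bsub>A\<^esub> \<alpha>) \<oplus>\<^bsub>A\<^esub> p \<odot>\<^bsub>A\<^esub> (D b \<oplus>\<^bsub>A\<^esub> Lam b \<odot>\<^bsub>A\<^esub> \<alpha>)
        \<oplus>\<^bsub>A\<^esub> (p \<otimes>\<^bsub>K\<^esub> r) \<odot>\<^bsub>A\<^esub> (a0 \<oplus>\<^bsub>A\<^esub> u \<odot>\<^bsub>A\<^esub> \<alpha>)"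
      by (simp add: smult_l_distr smult_r_distr smult_assoc1 M.a_ac)
    also have "\<dots> = (a \<oplus>\<^bsub>A\<^esub> p \<odot>\<^bsub>A\<^esub> \<alpha>) \<otimes>\<^bsub>A\<^esub> (b \<oplus>\<^bsub>A\<^esub> r \<odot>\<^bsub>A\<^esub> \<alpha>) \<oplus>\<^bsub>A\<^esub>
        (r \<otimes>\<^bsub>K\<^esub> q) \<odot>\<^bsub>A\<^esub> d (a \<oplus>\<^bsub>A\<^esub> p \<odot>\<^bsub>A\<^esub> \<alpha>) \<oplus>\<^bsub>A\<^esub> (p \<otimes>\<^bsub>K\<^esub> q) \<odot>\<^bsub>A\<^esub> D (b \<oplus>\<^bsub>A\<^esub> r \<odot>\<^bsub>A\<^esub> \<alpha>) \<oplus>\<^bsub>A\<^esub>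
        ((p \<otimes>\<^bsub>K\<^esub> q) \<otimes>\<^bsub>K\<^esub> (r \<otimes>\<^bsub>K\<^esub> q)) \<odot>\<^bsub>A\<^esub> a0"
      by (simp only: eqs that)
        (simp add: smult_l_distr smult_r_distr flag_add flag_smult A.l_distr A.r_distr
          smult_mult_left smult_mult_right M.a_ac K.m_ac flip: smult_assoc1)
    finally have 1: "a \<otimes>\<^bsub>A\<^esub> b \<oplus>\<^bsub>A\<^esub> r \<odot>\<^bsub>A\<^esub> d a \<oplus>\<^bsub>A\<^esub> p \<odot>\<^bsub>A\<^esub> D b \<oplus>\<^bsub>A\<^esub> (p \<otimes>\<^bsub>K\<^esub> r) \<odot>\<^bsub>A\<^esub> a0 \<oplus>\<^bsub>A\<^esub>
        (r \<otimes>\<^bsub>K\<^esub> lam a \<oplus>\<^bsub>K\<^esub> p \<otimes>\<^bsub>K\<^esub> Lam b \<oplus>\<^bsub>K\<^esub> (p \<otimes>\<^bsub>K\<^esub> r) \<otimes>\<^bsub>K\<^esub> u) \<odot>\<^bsub>A\<^esub> \<alpha> = \<dots>" .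
    \<comment> \<open>Since \<open>u\<close> recurs on the right of \<open>eq_u\<close>, rewriting
      from left to right would not terminate. The one intended occurrence is therefore written out
      expanded and folded back.\<close>
    have "(r \<otimes>\<^bsub>K\<^esub> lam a \<oplus>\<^bsub>K\<^esub> p \<otimes>\<^bsub>K\<^esub> Lam b \<oplus>\<^bsub>K\<^esub> (p \<otimes>\<^bsub>K\<^esub> r) \<otimes>\<^bsub>K\<^esub> u) \<otimes>\<^bsub>K\<^esub> q =
      (r \<otimes>\<^bsub>K\<^esub> lam a \<oplus>\<^bsub>K\<^esub> p \<otimes>\<^bsub>K\<^esub> Lam b \<oplus>\<^bsub>K\<^esub>
        (p \<otimes>\<^bsub>K\<^esub> r) \<otimes>\<^bsub>K\<^esub> (lam \<alpha> \<oplus>\<^bsub>K\<^esub> Lam \<alpha> \<oplus>\<^bsub>K\<^esub> q \<otimes>\<^bsub>K\<^esub> u)) \<otimes>\<^bsub>K\<^esub> q"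
      by (simp only: eq_u[symmetric])
    also have "\<dots> = (r \<otimes>\<^bsub>K\<^esub> q) \<otimes>\<^bsub>K\<^esub> lam (a \<oplus>\<^bsub>A\<^esub> p \<odot>\<^bsub>A\<^esub> \<alpha>) \<oplus>\<^bsub>K\<^esub>
        (p \<otimes>\<^bsub>K\<^esub> q) \<otimes>\<^bsub>K\<^esub> Lam (b \<oplus>\<^bsub>A\<^esub> r \<odot>\<^bsub>A\<^esub> \<alpha>) \<oplus>\<^bsub>K\<^esub> ((p \<otimes>\<^bsub>K\<^esub> q) \<otimes>\<^bsub>K\<^esub> (r \<otimes>\<^bsub>K\<^esub> q)) \<otimes>\<^bsub>K\<^esub> u"
      by (simp add: flag_add flag_smult K.l_distr K.r_distr K.m_ac K.a_ac)
    finally show ?thesis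
      using 1 by (simp add: flag_ext_mult)
  qed
  \<comment> \<open>Solving (b, r) = \<open>f (a, p)\<close> gives p = r/q and then a = b - (r/q)
    \<alpha>.\<close>
  define g where "g = (\<lambda>(a, p). (a \<ominus>\<^bsub>A\<^esub> (p \<otimes>\<^bsub>K\<^esub> inv\<^bsub>K\<^esub> q) \<odot>\<^bsub>A\<^esub> \<alpha>, p \<otimes>\<^bsub>K\<^esub> inv\<^bsub>K\<^esub> q))"
  have "bij_betw f (carrier E) (carrier E)"
  proof (rule bij_betwI[where g = g])
    show "f \<in> carrier E \<rightarrow> carrier E" by auto
    show "g \<in> carrier E \<rightarrow> carrier E" using q by (auto simp: g_def)
    show "g (f x) = x" if "x \<in> carrier E" for x
      using that q by (auto simp: g_def K.m_assoc M.minus_eq M.a_assoc M.r_neg)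
    show "f (g x) = x" if "x \<in> carrier E" for x
      using that q by (auto simp: g_def K.m_assoc M.minus_eq M.a_assoc M.l_neg)
  qed
  moreover have "f \<in> extensional (carrier E)"
    by (simp add: f_def flag_aut_def)
  \<comment> \<open>Sums and multiples in \<open>E\<close> stay folded, so that the goals match
    \<open>f_add\<close> and \<open>f_smult\<close>.\<close>
  moreover have "f \<in> algebra_hom K E E"
    using f_add f_mult f_smult by (auto simp: algebra_hom_iff simp del: flag_ext_simps(3,4))
  moreover have "f s = s" if "s \<in> base_of_ext K A" for s
    using that by (auto simp: base_of_ext_def)
  ultimately show ?thesis
    by (simp add: Gal_def Bij_def flip: f_def)
qed

section \<open>From automorphisms to pairs\<close>

text \<open>Every element is \<open>(a, 0) + p x\<close>, so linearity and the fixing of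
  \<open>A\<close> leave only the value at \<open>x\<close> free. Multiplicativity at
  \<open>a x\<close>, \<open>x a\<close> and \<open>x x\<close> then constrains that value.\<close>

lemma Gal_eq_flag_aut:
  assumes G: "\<sigma> \<in> carrier (Gal K (base_of_ext K A) E)"
  shows "\<sigma> (\<zero>\<^bsub>A\<^esub>, \<one>\<^bsub>K\<^esub>) \<in> carrier (flag_group K A Lam lam D d a0 u)"
    and "\<sigma> = flag_aut (\<sigma> (\<zero>\<^bsub>A\<^esub>, \<one>\<^bsub>K\<^esub>))"
proof -
  let ?x = "(\<zero>\<^bsub>A\<^esub>, \<one>\<^bsub>K\<^esub>)"
  obtain \<alpha> q where x: "\<sigma> ?x = (\<alpha>, q)" by fastforce
  have hom: "\<sigma> \<in> algebra_hom K E E" and bij: "\<sigma> \<in> Bij (carrier E)"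
    and base: "\<And>a. a \<in> carrier A \<Longrightarrow> \<sigma> (a, \<zero>\<^bsub>K\<^esub>) = (a, \<zero>\<^bsub>K\<^esub>)"
    using G by (auto simp: Gal_def base_of_ext_def)
  have "\<sigma> ?x \<in> carrier E"
    using hom unfolding algebra_hom_iff by simp
  then have [simp]: "\<alpha> \<in> carrier A" "q \<in> carrier K"
    using x by simp_all
  have add: "\<sigma> (y \<oplus>\<^bsub>E\<^esub> z) = \<sigma> y \<oplus>\<^bsub>E\<^esub> \<sigma> z"
    and mult: "\<sigma> (y \<otimes>\<^bsub>E\<^esub> z) = \<sigma> y \<otimes>\<^bsub>E\<^esub> \<sigma> z" if "y \<in> carrier E" "z \<in> carrier E" for y z
    using hom that unfolding algebra_hom_iff by blast+
  have smult: "\<sigma> (c \<odot>\<^bsub>E\<^esub> y) = c \<odot>\<^bsub>E\<^esub> \<sigma> y" if "c \<in> carrier K" "y \<in> carrier E" for c y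
    using hom that unfolding algebra_hom_iff by blast
  have \<sigma>: "\<sigma> (a, p) = (a \<oplus>\<^bsub>A\<^esub> p \<odot>\<^bsub>A\<^esub> \<alpha>, p \<otimes>\<^bsub>K\<^esub> q)"
    if "a \<in> carrier A" "p \<in> carrier K" for a p
  proof -
    have "\<sigma> ((a, \<zero>\<^bsub>K\<^esub>) \<oplus>\<^bsub>E\<^esub> p \<odot>\<^bsub>E\<^esub> ?x) = \<sigma> (a, \<zero>\<^bsub>K\<^esub>) \<oplus>\<^bsub>E\<^esub> \<sigma> (p \<odot>\<^bsub>E\<^esub> ?x)"
      by (rule add) (use that in simp_all)
    also have "\<sigma> (p \<odot>\<^bsub>E\<^esub> ?x) = p \<odot>\<^bsub>E\<^esub> \<sigma> ?x"
      by (rule smult) (use that in simp_all)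
    finally show ?thesis
      using that by (simp add: base x)
  qed
  \<comment> \<open>Here and for \<open>D\<close> only the \<open>A\<close>-component carries
    information: the \<open>K\<close>-components are \<open>lam a\<close> or \<open>Lam a\<close>
    times \<open>q\<close> on both sides.\<close>
  have d: "d a \<oplus>\<^bsub>A\<^esub> lam a \<odot>\<^bsub>A\<^esub> \<alpha> = a \<otimes>\<^bsub>A\<^esub> \<alpha> \<oplus>\<^bsub>A\<^esub> q \<odot>\<^bsub>A\<^esub> d a" if "a \<in> carrier A" for a
    using mult[of "(a, \<zero>\<^bsub>K\<^esub>)" ?x] that
    by (simp add: flag_ext_relations(2)[OF flag] base x \<sigma>) (simp add: flag_ext_mult)
  have D: "D a \<oplus>\<^bsub>A\<^esub> Lam a \<odot>\<^bsub>A\<^esub> \<alpha> = \<alpha> \<otimes>\<^bsub>A\<^esub> a \<oplus>\<^bsub>A\<^esub> q \<odot>\<^bsub>A\<^esub> D a" if "a \<in> carrier A" for a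
    using mult[of ?x "(a, \<zero>\<^bsub>K\<^esub>)"] that
    by (simp add: flag_ext_relations(3)[OF flag] base x \<sigma>) (simp add: flag_ext_mult)
  have "\<sigma> (a0, u) = (\<alpha>, q) \<otimes>\<^bsub>E\<^esub> (\<alpha>, q)"
    using mult[of ?x ?x] by (simp add: flag_ext_relations(1)[OF flag] x)
  \<comment> \<open>The \<open>K\<close>-component has a factor \<open>q\<close> on both sides,
    which can be cancelled only after \<open>q\<close> is shown to be nonzero.\<close>
  then have a0: "a0 \<oplus>\<^bsub>A\<^esub> u \<odot>\<^bsub>A\<^esub> \<alpha> =
        \<alpha> \<otimes>\<^bsub>A\<^esub> \<alpha> \<oplus>\<^bsub>A\<^esub> q \<odot>\<^bsub>A\<^esub> d \<alpha> \<oplus>\<^bsub>A\<^esub> q \<odot>\<^bsub>A\<^esub> D \<alpha> \<oplus>\<^bsub>A\<^esub> (q \<otimes>\<^bsub>K\<^esub> q) \<odot>\<^bsub>A\<^esub> a0"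
    and uq: "u \<otimes>\<^bsub>K\<^esub> q = q \<otimes>\<^bsub>K\<^esub> lam \<alpha> \<oplus>\<^bsub>K\<^esub> q \<otimes>\<^bsub>K\<^esub> Lam \<alpha> \<oplus>\<^bsub>K\<^esub> q \<otimes>\<^bsub>K\<^esub> q \<otimes>\<^bsub>K\<^esub> u"
    by (simp_all add: \<sigma> flag_ext_mult)
  have "q \<noteq> \<zero>\<^bsub>K\<^esub>"
  proof
    assume "q = \<zero>\<^bsub>K\<^esub>"
    then have "\<sigma> ?x = \<sigma> (\<alpha>, \<zero>\<^bsub>K\<^esub>)"
      by (simp add: x base)
    moreover have "inj_on \<sigma> (carrier E)"
      using bij by (simp add: Bij_def bij_betw_def)
    ultimately have "?x = (\<alpha>, \<zero>\<^bsub>K\<^esub>)"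
      by (simp only: inj_on_eq_iff flag_ext_simps mem_Times_iff fst_conv snd_conv
          M.zero_closed K.zero_closed K.one_closed \<open>\<alpha> \<in> carrier A\<close>)
    then show False by simp
  qed
  then have q: "q \<in> Units K"
    by (simp add: K.field_Units)
  have "q \<otimes>\<^bsub>K\<^esub> u = q \<otimes>\<^bsub>K\<^esub> (lam \<alpha> \<oplus>\<^bsub>K\<^esub> Lam \<alpha> \<oplus>\<^bsub>K\<^esub> q \<otimes>\<^bsub>K\<^esub> u)"
    using uq by (simp add: K.r_distr K.m_assoc K.m_comm[of u q])
  then have "u = lam \<alpha> \<oplus>\<^bsub>K\<^esub> Lam \<alpha> \<oplus>\<^bsub>K\<^esub> q \<otimes>\<^bsub>K\<^esub> u"
    using \<open>q \<noteq> \<zero>\<^bsub>K\<^esub>\<close> K.m_lcancel by simp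
  with d D a0 q show "\<sigma> ?x \<in> carrier (flag_group K A Lam lam D d a0 u)"
    by (simp add: x carrier_flag_group_iff)
  \<comment> \<open>Both maps are extensional, so agreement on the carrier gives equality.\<close>
  show "\<sigma> = flag_aut (\<sigma> ?x)"
  proof (rule extensionalityI)
    show "\<sigma> \<in> extensional (carrier E)"
      using bij by (simp add: Bij_def)
    show "flag_aut (\<sigma> ?x) \<in> extensional (carrier E)"
      by (simp add: x flag_aut_def)
    show "\<sigma> y = flag_aut (\<sigma> ?x) y" if "y \<in> carrier E" for y
      using that by (auto simp: x \<sigma> flag_aut_def)
  qed
qed

text \<open>Together with \<open>Gal_eq_flag_aut\<close> this makes \<open>flag_aut\<close> and
  evaluation at \<open>x\<close> mutually inverse.\<close>

lemma flag_aut_x: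
  assumes "(\<alpha>, q) \<in> carrier (flag_group K A Lam lam D d a0 u)"
  shows "flag_aut (\<alpha>, q) (\<zero>\<^bsub>A\<^esub>, \<one>\<^bsub>K\<^esub>) = (\<alpha>, q)"
  using assms by (auto simp: carrier_flag_group_iff flag_aut_def)

section \<open>The isomorphism and the group axioms for pairs\<close>

text \<open>The map goes from the Galois group to the pairs because \<open>iso\<close> speaks only
  of products and bijectivity: it can be established first and then carry the group axioms over. As
  \<open>BijGroup\<close> applies the right factor first, no reversal of order occurs.\<close>

lemma eval_x_iso:
  "(\<lambda>\<sigma>. \<sigma> (\<zero>\<^bsub>A\<^esub>, \<one>\<^bsub>K\<^esub>)) \<in>
    iso (Gal K (base_of_ext K A) E) (flag_group K A Lam lam D d a0 u)"
proof (rule isoI)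
  show "(\<lambda>\<sigma>. \<sigma> (\<zero>\<^bsub>A\<^esub>, \<one>\<^bsub>K\<^esub>)) \<in>
    hom (Gal K (base_of_ext K A) E) (flag_group K A Lam lam D d a0 u)"
  proof (rule homI)
    fix \<sigma> \<tau>
    assume st: "\<sigma> \<in> carrier (Gal K (base_of_ext K A) E)" "\<tau> \<in> carrier (Gal K (base_of_ext K A) E)"
    then have prod: "\<sigma> \<otimes>\<^bsub>Gal K (base_of_ext K A) E\<^esub> \<tau> = compose (carrier E) \<sigma> \<tau>"
      by (simp add: Gal_def BijGroup_def)
    obtain \<alpha> q \<beta> r where x: "\<sigma> (\<zero>\<^bsub>A\<^esub>, \<one>\<^bsub>K\<^esub>) = (\<alpha>, q)" "\<tau> (\<zero>\<^bsub>A\<^esub>, \<one>\<^bsub>K\<^esub>) = (\<beta>, r)"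
      by fastforce
    then have [simp]: "\<alpha> \<in> carrier A" "q \<in> carrier K" "\<beta> \<in> carrier A" "r \<in> carrier K"
      using st[THEN Gal_eq_flag_aut(1)] by (auto simp: carrier_flag_group_iff)
    have "\<sigma> = flag_aut (\<alpha>, q)"
      using Gal_eq_flag_aut(2)[OF st(1)] x by simp
    then have "\<sigma> (\<beta>, r) = (\<beta> \<oplus>\<^bsub>A\<^esub> r \<odot>\<^bsub>A\<^esub> \<alpha>, r \<otimes>\<^bsub>K\<^esub> q)"
      by (simp add: flag_aut_def)
    then show "(\<sigma> \<otimes>\<^bsub>Gal K (base_of_ext K A) E\<^esub> \<tau>) (\<zero>\<^bsub>A\<^esub>, \<one>\<^bsub>K\<^esub>) =
        \<sigma> (\<zero>\<^bsub>A\<^esub>, \<one>\<^bsub>K\<^esub>) \<otimes>\<^bsub>flag_group K A Lam lam D d a0 u\<^esub> \<tau> (\<zero>\<^bsub>A\<^esub>, \<one>\<^bsub>K\<^esub>)"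
      \<comment> \<open>The scalar parts come out as \<open>r q\<close> and \<open>q r\<close>,
        hence commutativity of the field.\<close>
      by (simp add: prod compose_eq x flag_group_def K.m_comm)
  qed (rule Gal_eq_flag_aut)
  show "bij_betw (\<lambda>\<sigma>. \<sigma> (\<zero>\<^bsub>A\<^esub>, \<one>\<^bsub>K\<^esub>)) (carrier (Gal K (base_of_ext K A) E))
      (carrier (flag_group K A Lam lam D d a0 u))"
    by (rule bij_betwI[where g = flag_aut])
      (use Gal_eq_flag_aut flag_aut_in_Gal flag_aut_x in force)+
qed

lemma group_flag_group: "group (flag_group K A Lam lam D d a0 u)"
proof -
  \<comment> \<open>The transported structure is \<open>flag_group\<close> with its unit replaced by
    the image of the unit; this equation shows that the replacement changes nothing.\<close>
  have "\<one>\<^bsub>Gal K (base_of_ext K A) E\<^esub> (\<zero>\<^bsub>A\<^esub>, \<one>\<^bsub>K\<^esub>) = \<one>\<^bsub>flag_group K A Lam lam D d a0 u\<^esub>"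
    by (simp add: Gal_def BijGroup_def flag_group_def)
  then show ?thesis
    using group.iso_imp_img_group[OF group_Gal_flag_ext eval_x_iso] by simp
qed

end

theorem corollary3p5:
  fixes K :: "('k, 'm) ring_scheme" and A :: "('k, 'a, 'n) module_scheme"
  assumes "assoc_algebra K A"
    and "(Lam, lam, D, d, a0, u) \<in> flag_data K A"
  shows "group (Gal K (base_of_ext K A) (flag_ext K A Lam lam D d a0 u)) \<and>
    group (flag_group K A Lam lam D d a0 u) \<and>
    Gal K (base_of_ext K A) (flag_ext K A Lam lam D d a0 u)
      \<cong> flag_group K A Lam lam D d a0 u"
proof -
  interpret flag_extension K A Lam lam D d a0 u
    using assms by (intro flag_extension.intro flag_extension_axioms.intro)
  show ?thesis
    using group_Gal_flag_ext group_flag_group is_isoI[OF eval_x_iso] by blast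
qed

end
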